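(* Let $v$ be any continuous solution of the equation $$0=\sup_{(c,a)\in\mathcal{C}\times\mathcal{I}}\left[(A_c(\tau_a(x))-m)+d_xv(a)\right],\qquad x\in\mathbf{S}^1.$$ Then a measure $\mu\in\mathcal{H}$ is a maximizing measure if, and only if, $$\operatorname{supp}\mu\subseteq\left\{(x,c,a) : 0=(A_c(\tau_a(x))-m)+d_xv(a)\right\}.$$ In particular, the graph $\{(x,v(x)) : x\in\mathbf{S}^1\}$ is essentially backwards invariant, that is, for maximizing $\mu$, $\bar G_c(\tau_a(x),v(\tau_a(x)))=(x,v(x))$ for $\mu$-a.e. $(x,c,a)$.
   Context: $X=\mathbf{S}^1=\mathbb{R}/\mathbb{Z}$, $T:X\to X$ is the doubling map $T(x)=2x$, $\mathcal{C}$ is a finite set with at least two elements, $\mathcal{I}=\{0,1\}$, $\tau_i(x)=\frac12x+\frac i2$ (with $x\in[0,1)$ as representative), $i\in\mathcal{I}$, are the inverse branches of $T$, and $A_c:X\to\mathbb{R}$, $c\in\mathcal{C}$, are Lipschitz functions. For $g\in C^0(X,\mathbb{R})$ put $d_xg(a)=g(\tau_a(x))-g(x)$. The set of holonomic probabilities is $$\mathcal{H}=\left\{\mu\in\mathrm{Prob}(X\times\mathcal{C}\times\mathcal{I}) : \int d_xg(a)\,d\mu(x,c,a)=0\ \ \forall g\in C^0(X,\mathbb{R})\right\}.$$ The number $m$ is $m=\sup_{\mu\in\mathcal{H}}\int A_c(\tau_a(x))\,d\mu(x,c,a)$, and $\mu\in\mathcal{H}$ is maximizing if $\int A_c(\tau_a(x))\,d\mu(x,c,a)=m$.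 The modified maps are $\bar G_c:X\times\mathbb{R}\to X\times\mathbb{R}$, $\bar G_c(x,y)=(T(x),(A_c(x)-m)+y)$.
   Formalization: In the equivalence, supp μ is taken with the topology of [0,1) on x, in which each τ_a is continuous. For the usual topology of S^1, "if" is proved as stated, but "only if" just for points with x ≠ 0, since over x = 0 it can fail (τ_a jumps there). *)

theory Defs
  imports "HOL-Probability.Probability"
begin

quotient_type circle = real / "\<lambda>x y. x - y \<in> \<int>"
proof (rule equivpI)
  show "reflp (\<lambda>x y::real. x - y \<in> \<int>)" by (simp add: reflp_def)
  show "symp (\<lambda>x y::real. x - y \<in> \<int>)"
    unfolding symp_def by (metis Ints_minus minus_diff_eq)
  show "transp (\<lambda>x y::real. x - y \<in> \<int>)"
    unfolding transp_def
  proof (intro allI impI)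
    fix x y z :: real
    assume "x - y \<in> \<int>" "y - z \<in> \<int>"
    then have "(x - y) + (y - z) \<in> \<int>" by (rule Ints_add)
    then show "x - z \<in> \<int>" by simp
  qed
qed

lift_definition to_circle :: "real \<Rightarrow> circle" is "\<lambda>x. x" .

lemma Ints_diff_imp_shift:
  fixes x y :: real
  assumes "x - y \<in> \<int>"
  obtains n :: int where "x = y + of_int n"
proof -
  obtain n where "x - y = of_int n" using assms by (elim Ints_cases)
  then have "x = y + of_int n" by simp
  then show thesis by (rule that)
qed

lemma round_add_int:
  fixes x :: real
  shows "round (x + of_int n) = round x + n"
proof -
  have "x + of_int n + 1 / 2 = (x + 1 / 2) + of_int n" by simp
  then show ?thesis by (simp only: round_def floor_add_int)
qed

text \<open>The representative in the half-open unit interval. It is not continuous at \<open>to_circle 0\<close>.\<close>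

lift_definition rep :: "circle \<Rightarrow> real" is "\<lambda>x. frac x"
  by (elim Ints_diff_imp_shift) (simp add: frac_def)

text \<open>The quotient metric: since \<open>round z\<close> is an integer nearest to \<open>z\<close>, the distance below is the
  minimum of \<open>\<bar>x - y - n\<bar>\<close> over all integers \<open>n\<close>.\<close>

instantiation circle :: metric_space
begin

lift_definition dist_circle :: "circle \<Rightarrow> circle \<Rightarrow> real"
  is "\<lambda>x y. \<bar>(x - y) - of_int (round (x - y))\<bar>"
proof -
  fix x x' y y' :: real
  assume "x - x' \<in> \<int>" "y - y' \<in> \<int>"
  then obtain m n :: int where "x = x' + of_int m" "y = y' + of_int n"
    by (elim Ints_diff_imp_shift)
  then have "x - y = (x' - y') + of_int (m - n)" by simp
  moreover have "round ((x' - y') + of_int (m - n)) = round (x' - y') + (m - n)"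
    by (rule round_add_int)
  ultimately have "x - y - of_int (round (x - y)) = (x' - y') - of_int (round (x' - y'))"
    by simp
  then show "\<bar>(x - y) - of_int (round (x - y))\<bar> = \<bar>(x' - y') - of_int (round (x' - y'))\<bar>" by simp
qed

definition uniformity_circle :: "(circle \<times> circle) filter"
  where "uniformity_circle = (INF e\<in>{0 <..}. principal {(x, y). dist x y < e})"

definition open_circle :: "circle set \<Rightarrow> bool"
  where "open_circle U \<longleftrightarrow> (\<forall>x\<in>U. \<forall>\<^sub>F (x', y) in uniformity. x' = x \<longrightarrow> y \<in> U)"

instance
proof
  fix x y z :: circle
  show "dist x y = 0 \<longleftrightarrow> x = y"
  proof transfer
    fix x y :: real
    show "\<bar>x - y - of_int (round (x - y))\<bar> = 0 \<longleftrightarrow> x - y \<in> \<int>"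
    proof
      assume "\<bar>x - y - of_int (round (x - y))\<bar> = 0"
      then have "x - y = of_int (round (x - y))" by simp
      then show "x - y \<in> \<int>" by (metis Ints_of_int)
    next
      assume "x - y \<in> \<int>"
      then show "\<bar>x - y - of_int (round (x - y))\<bar> = 0" by (elim Ints_cases) simp
    qed
  qed
  show "dist x y \<le> dist x z + dist y z"
  proof transfer
    fix x y z :: real
    have "\<bar>x - y - of_int (round (x - y))\<bar>
        \<le> \<bar>x - y - of_int (round (x - z) - round (y - z))\<bar>"
      by (rule round_diff_minimal)
    also have "\<dots> = \<bar>(x - z - of_int (round (x - z))) - (y - z - of_int (round (y - z)))\<bar>"
      by (simp add: algebra_simps)
    also have "\<dots> \<le> \<bar>x - z - of_int (round (x - z))\<bar> + \<bar>y - z - of_int (round (y - z))\<bar>"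
      by (rule abs_triangle_ineq4)
    finally show "\<bar>x - y - of_int (round (x - y))\<bar>
        \<le> \<bar>x - z - of_int (round (x - z))\<bar> + \<bar>y - z - of_int (round (y - z))\<bar>" .
  qed
qed (simp_all add: uniformity_circle_def open_circle_def)

end

lift_definition doubling :: "circle \<Rightarrow> circle" is "\<lambda>x. 2 * x"
  by (elim Ints_diff_imp_shift) simp

definition tau :: "nat \<Rightarrow> circle \<Rightarrow> circle"
  where "tau i x = to_circle (rep x / 2 + real i / 2)"

abbreviation branches :: "nat set"
  where "branches \<equiv> {0, 1}"

definition d_op :: "circle \<Rightarrow> (circle \<Rightarrow> real) \<Rightarrow> nat \<Rightarrow> real"
  where "d_op x g a = g (tau a x) - g x"

definition prob_measures :: "'c set \<Rightarrow> (circle \<times> 'c \<times> nat) measure set"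
  where "prob_measures C = {\<mu>. prob_space \<mu> \<and>
    sets \<mu> = sets (borel \<Otimes>\<^sub>M (count_space C \<Otimes>\<^sub>M count_space branches))}"

definition holonomic :: "'c set \<Rightarrow> (circle \<times> 'c \<times> nat) measure set"
  where "holonomic C = {\<mu> \<in> prob_measures C.
    \<forall>g. continuous_on UNIV g \<longrightarrow> (\<integral>(x, c, a). d_op x g a \<partial>\<mu>) = 0}"

definition action :: "('c \<Rightarrow> circle \<Rightarrow> real) \<Rightarrow> (circle \<times> 'c \<times> nat) measure \<Rightarrow> real"
  where "action A \<mu> = (\<integral>(x, c, a). A c (tau a x) \<partial>\<mu>)"

definition max_action :: "'c set \<Rightarrow> ('c \<Rightarrow> circle \<Rightarrow> real) \<Rightarrow> real"
  where "max_action C A = (SUP \<mu>\<in>holonomic C. action A \<mu>)"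

definition maximizing :: "'c set \<Rightarrow> ('c \<Rightarrow> circle \<Rightarrow> real) \<Rightarrow> (circle \<times> 'c \<times> nat) measure \<Rightarrow> bool"
  where "maximizing C A \<mu> \<longleftrightarrow> \<mu> \<in> holonomic C \<and> action A \<mu> = max_action C A"

definition G_bar :: "'c set \<Rightarrow> ('c \<Rightarrow> circle \<Rightarrow> real) \<Rightarrow> 'c \<Rightarrow> circle \<times> real \<Rightarrow> circle \<times> real"
  where "G_bar C A c = (\<lambda>(x, y). (doubling x, (A c x - max_action C A) + y))"

definition contact_set :: "'c set \<Rightarrow> ('c \<Rightarrow> circle \<Rightarrow> real) \<Rightarrow> (circle \<Rightarrow> real) \<Rightarrow> (circle \<times> 'c \<times> nat) set"
  where "contact_set C A v = {(x, c, a). c \<in> C \<and> a \<in> branches \<and>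
    0 = (A c (tau a x) - max_action C A) + d_op x v a}"

definition supp :: "'a topology \<Rightarrow> 'a measure \<Rightarrow> 'a set"
  where "supp S \<mu> = {p \<in> topspace S. \<forall>U. openin S U \<and> p \<in> U \<longrightarrow> emeasure \<mu> U > 0}"

definition phase_topology :: "circle topology \<Rightarrow> 'c set \<Rightarrow> (circle \<times> 'c \<times> nat) topology"
  where "phase_topology S C =
    prod_topology S (prod_topology (discrete_topology C) (discrete_topology branches))"

text \<open>
  The branches \<open>tau 0\<close> and \<open>tau 1\<close> jump at \<open>to_circle 0\<close> for the usual topology of the circle. The
  topology below identifies the circle with the interval of representatives \<open>{0..<1}\<close>; in it both
  branches are continuous as maps to the circle. It is finer than the usual topology, differs from
  it only at neighbourhoods of \<open>to_circle 0\<close>, and has the same Borel sets.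

  The distinction matters for supports. Let \<open>C = {c, c'}\<close>, let \<open>A c'\<close> vanish, let \<open>A c y\<close> be minus
  the positive part of \<open>1 / 4 - dist y (to_circle 0)\<close>, and let \<open>v = 0\<close>, so \<open>max_action C A = 0\<close>.
  Take Lebesgue measure in \<open>x\<close>, choose \<open>a\<close> with probability \<open>1 / 2\<close> each, and then the symbol \<open>c\<close> if
  \<open>dist (tau a x) (to_circle 0) \<ge> 1 / 4\<close> and \<open>c'\<close> otherwise. This measure is maximizing, and
  \<open>(to_circle 0, c, 0)\<close> is in its support for the usual topology, as the limit of \<open>(x, c, 0)\<close> when
  \<open>rep x\<close> tends to \<open>1\<close>; but \<open>A c (tau 0 (to_circle 0)) = - 1 / 4\<close>, so this point is not in
  \<open>contact_set C A v\<close>.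
\<close>

definition interval_topology :: "circle topology"
  where "interval_topology = pullback_topology UNIV rep euclidean"

end

theory Submission
  imports Defs
begin

text \<open>
  Write \<open>gap(x, c, a) = A c (tau a x) - m + v (tau a x) - v x\<close>. The equation for \<open>v\<close> says in
  particular that \<open>gap \<le> 0\<close>. If \<open>\<mu>\<close> is holonomic, the coboundary \<open>v (tau a x) - v x\<close> integrates to
  zero, so \<open>\<integral> gap \<partial>\<mu> = action A \<mu> - m\<close> (lemma \<open>integral_gap\<close>). Hence \<open>\<mu>\<close> is maximizing iff the
  integral of the nonpositive function \<open>gap\<close> vanishes, iff \<open>gap = 0\<close> almost everywhere, iff the
  contact set has full measure (lemma \<open>maximizing_iff_AE_contact\<close>). On the contact set,
  \<open>doubling (tau a x) = x\<close> turns \<open>gap = 0\<close> into the invariance of the graph of \<open>v\<close>.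

  What remains is to pass between full measure and supports. In a second countable topology with
  measurable open sets the support has full measure (lemma \<open>AE_in_supp\<close>), so a measure whose
  support is in the contact set gives it full measure. Conversely, \<open>gap\<close> is continuous for the
  interval topology, so a point of the support outside the contact set would have a neighbourhood
  of positive measure that avoids the contact set (lemma \<open>AE_contact_iff_supp_interval\<close>).

  The usual topology of the circle is coarser than the interval topology, so it gives larger
  supports; and the two topologies agree away from \<open>to_circle 0\<close>, so the supports differ only over
  that point. The claims about the usual topology follow from these two inclusions.
\<close>

section \<open>Second countability and supports\<close>

lemma second_countable_euclidean:
  "second_countable (euclidean :: 'a::second_countable_topology topology)"
proof -
  obtain B :: "'a set set" where B: "countable B" "topological_basis B"
    using ex_countable_basis by blast
  then show ?thesis
    unfolding second_countable_def
    by (intro exI[of _ B]) (metis open_openin topological_basisE topological_basis_open)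
qed

lemma second_countable_prod_topology:
  assumes "second_countable X" "second_countable Y"
  shows "second_countable (prod_topology X Y)"
proof -
  obtain B where B: "countable B" "\<And>V. V \<in> B \<Longrightarrow> openin X V"
      "\<And>U x. openin X U \<Longrightarrow> x \<in> U \<Longrightarrow> \<exists>V \<in> B. x \<in> V \<and> V \<subseteq> U"
    using assms(1) unfolding second_countable_def by metis
  obtain D where D: "countable D" "\<And>V. V \<in> D \<Longrightarrow> openin Y V"
      "\<And>U x. openin Y U \<Longrightarrow> x \<in> U \<Longrightarrow> \<exists>V \<in> D. x \<in> V \<and> V \<subseteq> U"
    using assms(2) unfolding second_countable_def by metis
  show ?thesis
    unfolding second_countable_def
  proof (intro exI[of _ "(\<lambda>(U, V). U \<times> V) ` (B \<times> D)"] conjI ballI allI impI)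
    show "countable ((\<lambda>(U, V). U \<times> V) ` (B \<times> D))"
      using B(1) D(1) by simp
  next
    fix V assume "V \<in> (\<lambda>(U, V). U \<times> V) ` (B \<times> D)"
    then show "openin (prod_topology X Y) V"
      using B(2) D(2) by (auto simp: openin_prod_Times_iff)
  next
    fix W z assume W: "openin (prod_topology X Y) W \<and> z \<in> W"
    obtain x y where z: "z = (x, y)" by (cases z)
    obtain U V where UV: "openin X U" "openin Y V" "x \<in> U" "y \<in> V" "U \<times> V \<subseteq> W"
      using W z unfolding openin_prod_topology_alt by blast
    obtain U' where U': "U' \<in> B" "x \<in> U'" "U' \<subseteq> U" using B(3) UV by blast
    obtain V' where V': "V' \<in> D" "y \<in> V'" "V' \<subseteq> V" using D(3) UV by blast
    show "\<exists>V\<in>(\<lambda>(U, V). U \<times> V) ` (B \<times> D). z \<in> V \<and> V \<subseteq> W"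
      using U' V' UV(5) z by (intro bexI[of _ "U' \<times> V'"]) auto
  qed
qed

lemma second_countable_pullback_topology:
  assumes "second_countable X"
  shows "second_countable (pullback_topology A f X)"
proof -
  obtain B where B: "countable B" "\<And>V. V \<in> B \<Longrightarrow> openin X V"
      "\<And>U x. openin X U \<Longrightarrow> x \<in> U \<Longrightarrow> \<exists>V \<in> B. x \<in> V \<and> V \<subseteq> U"
    using assms unfolding second_countable_def by metis
  show ?thesis
    unfolding second_countable_def
  proof (intro exI[of _ "(\<lambda>V. f -` V \<inter> A) ` B"] conjI ballI allI impI)
    show "countable ((\<lambda>V. f -` V \<inter> A) ` B)"
      using B(1) by simp
  next
    fix V assume "V \<in> (\<lambda>V. f -` V \<inter> A) ` B"
    then show "openin (pullback_topology A f X) V"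
      using B(2) by (auto simp: openin_pullback_topology)
  next
    fix W x assume W: "openin (pullback_topology A f X) W \<and> x \<in> W"
    then obtain U where U: "openin X U" "W = f -` U \<inter> A" "f x \<in> U" "x \<in> A"
      by (auto simp: openin_pullback_topology)
    then obtain V where "V \<in> B" "f x \<in> V" "V \<subseteq> U" using B(3) by blast
    then show "\<exists>V\<in>(\<lambda>V. f -` V \<inter> A) ` B. x \<in> V \<and> V \<subseteq> W"
      using U by (intro bexI[of _ "f -` V \<inter> A"]) auto
  qed
qed

text \<open>
  Every point outside the support lies in a null set of the countable base, and the union of these
  null sets is null.
\<close>

lemma AE_in_supp:
  assumes "second_countable S"
    and meas: "\<And>U. openin S U \<Longrightarrow> U \<in> sets \<mu>"
    and space: "space \<mu> \<subseteq> topspace S"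
  shows "AE p in \<mu>. p \<in> supp S \<mu>"
proof -
  obtain B where B: "countable B" "\<And>V. V \<in> B \<Longrightarrow> openin S V"
      "\<And>U x. openin S U \<Longrightarrow> x \<in> U \<Longrightarrow> \<exists>V \<in> B. x \<in> V \<and> V \<subseteq> U"
    using assms(1) unfolding second_countable_def by metis
  let ?N = "\<Union>V\<in>B \<inter> null_sets \<mu>. V"
  have "?N \<in> null_sets \<mu>"
    by (rule null_sets_UN') (use B(1) in auto)
  moreover have "p \<in> supp S \<mu>" if "p \<in> space \<mu>" "p \<notin> ?N" for p
  proof -
    have "emeasure \<mu> U > 0" if U: "openin S U" "p \<in> U" for U
    proof (rule ccontr)
      assume "\<not> emeasure \<mu> U > 0"
      then have U0: "U \<in> null_sets \<mu>" using meas[OF U(1)] by (auto simp: zero_less_iff_neq_zero)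
      obtain V where V: "V \<in> B" "p \<in> V" "V \<subseteq> U" using B(3) U by blast
      then have "V \<in> null_sets \<mu>" using null_sets_subset[OF U0] meas[OF B(2)] by blast
      then show False using V \<open>p \<notin> ?N\<close> by blast
    qed
    then show ?thesis using space \<open>p \<in> space \<mu>\<close> by (auto simp: supp_def)
  qed
  ultimately show ?thesis
    by (auto intro!: AE_I'[of ?N])
qed

section \<open>The circle and its interval of representatives\<close>

lemma to_circle_rep [simp]: "to_circle (rep x) = x"
  by transfer (simp add: frac_def)

lemma rep_bounds: "0 \<le> rep x" "rep x < 1"
  by (transfer, simp add: frac_lt_1)+

lemma rep_eq_0_iff: "rep x = 0 \<longleftrightarrow> x = to_circle 0"
  by transfer (simp add: frac_eq_0_iff)

lemma dist_to_circle_le: "dist (to_circle r) (to_circle s) \<le> \<bar>r - s\<bar>"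
  by transfer (metis diff_zero of_int_0 round_diff_minimal)

lemma continuous_to_circle: "continuous_on UNIV to_circle"
  unfolding continuous_on_iff
  by (metis dist_real_def dist_to_circle_le le_less_trans)

text \<open>
  The circle distance is \<open>\<bar>rep y - rep x - n\<bar>\<close> with \<open>n\<close> one of \<open>-1, 0, 1\<close>. The values \<open>n = \<plusminus>1\<close> belong
  to an arc through \<open>to_circle 0\<close>, which is excluded when \<open>y\<close> is nearer to \<open>x\<close> than \<open>to_circle 0\<close> is.
  This is why \<open>rep\<close> is continuous away from \<open>to_circle 0\<close>.
\<close>

lemma dist_rep_near:
  assumes "dist y x < rep x" "dist y x < 1 - rep x"
  shows "\<bar>rep y - rep x\<bar> = dist y x"
proof -
  define n where "n = round (rep y - rep x)"
  have d: "dist y x = \<bar>rep y - rep x - of_int n\<bar>"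
    using dist_circle.abs_eq unfolding n_def
    by (metis to_circle.abs_eq to_circle_rep)
  have "of_int n > (-1::real)" "of_int n < (1::real)"
    using assms rep_bounds[of x] rep_bounds[of y] unfolding d by linarith+
  then have "n = 0" by linarith
  then show ?thesis using d by simp
qed

lemma continuous_rep: "continuous_on (- {to_circle 0}) rep"
  unfolding continuous_on_iff
proof (intro ballI allI impI)
  fix x e assume x: "x \<in> - {to_circle 0}" and "(0::real) < e"
  have "0 < rep x" using rep_bounds(1)[of x] rep_eq_0_iff[of x] x by force
  then show "\<exists>d>0. \<forall>y\<in>- {to_circle 0}. dist y x < d \<longrightarrow> dist (rep y) (rep x) < e"
    using rep_bounds[of x] \<open>0 < e\<close>
    by (intro exI[of _ "min e (min (rep x) (1 - rep x))"])
      (auto simp: dist_real_def dist_rep_near)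
qed

lemma rep_measurable: "rep \<in> borel_measurable borel"
  by (rule borel_measurable_continuous_countable_exceptions[of "{to_circle 0}"])
    (auto intro: continuous_rep)

lemma doubling_tau: "doubling (tau a x) = x"
proof -
  have "doubling (tau a x) = to_circle (rep x + real a)"
    unfolding tau_def by transfer simp
  also have "\<dots> = x"
    by transfer (simp add: frac_def)
  finally show ?thesis .
qed

lemma topspace_interval_topology: "topspace interval_topology = UNIV"
  by (simp add: interval_topology_def topspace_pullback_topology)

lemma open_imp_openin_interval_topology:
  assumes "open U"
  shows "openin interval_topology U"
proof -
  have "open (to_circle -` U)"
    using assms continuous_to_circle by (simp add: open_vimage)
  moreover have "U = rep -` (to_circle -` U)" by auto
  ultimately show ?thesis
    unfolding interval_topology_def openin_pullback_topology by auto
qed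

lemma openin_interval_topology_imp_open:
  assumes "openin interval_topology U"
  shows "open (U - {to_circle 0})"
proof -
  obtain V where V: "open V" "U = rep -` V"
    using assms unfolding interval_topology_def openin_pullback_topology by auto
  have "open (rep -` V \<inter> - {to_circle 0})"
    using continuous_rep V(1) by (subst (asm) continuous_on_open_vimage) auto
  then show ?thesis using V(2) by (simp add: Diff_eq)
qed

lemma openin_interval_topology_imp_borel:
  assumes "openin interval_topology U"
  shows "U \<in> sets borel"
proof -
  obtain V where V: "open V" "U = rep -` V"
    using assms unfolding interval_topology_def openin_pullback_topology by auto
  then show ?thesis using measurable_sets[OF rep_measurable, of V] by simp
qed

section \<open>Functions that extend continuously to the closed interval\<close>

text \<open>
  The functions \<open>F \<circ> rep\<close> with \<open>F\<close> continuous on the whole line. Continuity for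
  \<open>interval_topology\<close> alone would allow any behaviour as the representative tends to \<open>1\<close>; the
  extension \<open>F\<close> excludes this, so these functions are bounded by compactness of \<open>{0..1}\<close>. They
  include both the continuous functions on the circle and their compositions with the
  discontinuous branches \<open>tau a\<close>.
\<close>

definition interval_extendable :: "(circle \<Rightarrow> real) \<Rightarrow> bool"
  where "interval_extendable f \<longleftrightarrow> (\<exists>F. continuous_on UNIV F \<and> f = (\<lambda>x. F (rep x)))"

lemma interval_extendable_continuous:
  assumes "continuous_on UNIV g"
  shows "interval_extendable g"
  unfolding interval_extendable_def
  by (intro exI[of _ "\<lambda>r. g (to_circle r)"] conjI
      continuous_on_compose2[OF assms continuous_to_circle]) auto

lemma interval_extendable_tau:
  assumes "continuous_on UNIV g"
  shows "interval_extendable (\<lambda>x. g (tau a x))"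
  unfolding interval_extendable_def
proof (intro exI[of _ "\<lambda>r. g (to_circle (r / 2 + real a / 2))"] conjI)
  show "continuous_on UNIV (\<lambda>r. g (to_circle (r / 2 + real a / 2)))"
    by (rule continuous_on_compose2[OF assms continuous_on_compose2[OF continuous_to_circle]])
      (auto intro!: continuous_intros)
qed (simp add: tau_def)

lemma interval_extendable_add:
  assumes "interval_extendable f" "interval_extendable g"
  shows "interval_extendable (\<lambda>x. f x + g x)"
proof -
  obtain F G where "continuous_on UNIV F" "f = (\<lambda>x. F (rep x))"
    "continuous_on UNIV G" "g = (\<lambda>x. G (rep x))"
    using assms unfolding interval_extendable_def by blast
  then show ?thesis
    unfolding interval_extendable_def
    by (intro exI[of _ "\<lambda>r. F r + G r"]) (auto intro: continuous_intros)
qed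

lemma interval_extendable_diff:
  assumes "interval_extendable f" "interval_extendable g"
  shows "interval_extendable (\<lambda>x. f x - g x)"
proof -
  obtain F G where "continuous_on UNIV F" "f = (\<lambda>x. F (rep x))"
    "continuous_on UNIV G" "g = (\<lambda>x. G (rep x))"
    using assms unfolding interval_extendable_def by blast
  then show ?thesis
    unfolding interval_extendable_def
    by (intro exI[of _ "\<lambda>r. F r - G r"]) (auto intro: continuous_intros)
qed

lemma interval_extendable_measurable:
  assumes "interval_extendable f"
  shows "f \<in> borel_measurable borel"
  using assms rep_measurable
  by (auto simp: interval_extendable_def
      intro: measurable_compose borel_measurable_continuous_onI)

lemma interval_extendable_bounded:
  assumes "interval_extendable f"
  shows "bounded (range f)"
proof -
  obtain F where F: "continuous_on UNIV F" "f = (\<lambda>x. F (rep x))"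
    using assms unfolding interval_extendable_def by blast
  have "compact (F ` {0..1})"
    using F(1) by (intro compact_continuous_image) (auto intro: continuous_on_subset)
  moreover have "range f \<subseteq> F ` {0..1}"
    using rep_bounds by (force simp: F(2) intro: less_imp_le)
  ultimately show ?thesis
    using bounded_subset compact_imp_bounded by blast
qed

lemma interval_extendable_openin:
  assumes "interval_extendable f" "open V"
  shows "openin interval_topology (f -` V)"
proof -
  obtain F where F: "continuous_on UNIV F" "f = (\<lambda>x. F (rep x))"
    using assms(1) unfolding interval_extendable_def by blast
  then show ?thesis
    unfolding interval_topology_def openin_pullback_topology
    by (intro exI[of _ "F -` V"]) (auto simp: open_vimage assms(2))
qed

section \<open>The phase space\<close>

text \<open>
  The factors \<open>C\<close> and \<open>branches\<close> are discrete, so the phase space is a disjoint union of copies of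
  the circle, and openness can be checked on each copy.
\<close>

lemma openin_phase_topology_iff:
  "openin (phase_topology S C) W \<longleftrightarrow>
    W \<subseteq> UNIV \<times> C \<times> branches \<and> (\<forall>c\<in>C. \<forall>a\<in>branches. openin S {x. (x, c, a) \<in> W})"
    (is "_ \<longleftrightarrow> ?R")
proof
  assume W: "openin (phase_topology S C) W"
  have "W \<subseteq> UNIV \<times> C \<times> branches"
    using openin_subset[OF W] by (auto simp: phase_topology_def)
  moreover have "openin S {x. (x, c, a) \<in> W}" if "c \<in> C" "a \<in> branches" for c a
  proof (subst openin_subopen, intro ballI)
    fix x assume "x \<in> {x. (x, c, a) \<in> W}"
    then have "(x, c, a) \<in> W" by simp
    then obtain U V where "openin S U" "x \<in> U" "(c, a) \<in> V" "U \<times> V \<subseteq> W"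
      using W[unfolded phase_topology_def openin_prod_topology_alt[of S], rule_format, of x "(c, a)"]
      by metis
    then show "\<exists>T. openin S T \<and> x \<in> T \<and> T \<subseteq> {x. (x, c, a) \<in> W}"
      by (intro exI[of _ U]) auto
  qed
  ultimately show ?R by blast
next
  assume R: ?R
  show "openin (phase_topology S C) W"
    unfolding phase_topology_def prod_topology_discrete_topology[symmetric]
      openin_prod_topology_alt[of S]
  proof (intro allI impI)
    fix x p assume p: "(x, p) \<in> W"
    obtain c a where ca: "p = (c, a)" by (cases p)
    show "\<exists>U V. openin S U \<and> openin (discrete_topology (C \<times> branches)) V \<and>
        x \<in> U \<and> p \<in> V \<and> U \<times> V \<subseteq> W"
      using R p unfolding ca
      by (intro exI[of _ "{x. (x, c, a) \<in> W}"] exI[of _ "{(c, a)}"] conjI) auto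
  qed
qed

lemma openin_phase_topology_fibre:
  assumes "openin S U" "c \<in> C" "a \<in> branches"
  shows "openin (phase_topology S C) (U \<times> {(c, a)})"
proof -
  have "{x. x \<in> U \<and> c' = c \<and> a' = a} = (if c' = c \<and> a' = a then U else {})" for c' a'
    by auto
  then show ?thesis
    using assms by (auto simp: openin_phase_topology_iff)
qed

lemma topspace_phase_topology:
  "topspace (phase_topology S C) = topspace S \<times> C \<times> branches"
  by (simp add: phase_topology_def)

lemma second_countable_phase_topology:
  assumes "second_countable S" "countable C"
  shows "second_countable (phase_topology S C)"
  unfolding phase_topology_def
  by (intro second_countable_prod_topology assms(1))
    (simp_all add: second_countable_discrete_topology assms(2))

lemma second_countable_interval_topology: "second_countable interval_topology"
  unfolding interval_topology_def
  by (intro second_countable_pullback_topology second_countable_euclidean)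

lemma measurable_phase:
  assumes "\<mu> \<in> prob_measures C" "countable C"
    and f: "\<And>c a. c \<in> C \<Longrightarrow> a \<in> branches \<Longrightarrow> f c a \<in> measurable borel N"
  shows "(\<lambda>(x, c, a). f c a x) \<in> measurable \<mu> N"
proof -
  let ?M = "borel \<Otimes>\<^sub>M (count_space C \<Otimes>\<^sub>M count_space branches)"
  have "(\<lambda>p. f (fst (snd p)) (snd (snd p)) (fst p)) \<in> measurable ?M N"
  proof (rule measurable_compose_countable'[where I = C and g = "\<lambda>p. fst (snd p)"])
    fix c assume c: "c \<in> C"
    show "(\<lambda>p. f c (snd (snd p)) (fst p)) \<in> measurable ?M N"
    proof (rule measurable_compose_countable'[where I = branches and g = "\<lambda>p. snd (snd p)"])
      fix a assume "a \<in> branches"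
      then show "(\<lambda>p. f c a (fst p)) \<in> measurable ?M N"
        using f[OF c] by (intro measurable_compose[OF measurable_fst]) auto
    qed (auto intro: measurable_compose[OF measurable_snd])
  qed (auto intro: measurable_compose[OF measurable_snd] simp: assms(2))
  moreover have "sets \<mu> = sets ?M" using assms(1) by (simp add: prob_measures_def)
  ultimately show ?thesis
    by (simp add: measurable_cong_sets[of \<mu> ?M N N] case_prod_unfold)
qed

lemma space_phase:
  assumes "\<mu> \<in> prob_measures C"
  shows "space \<mu> = UNIV \<times> C \<times> branches"
  using assms sets_eq_imp_space_eq[of \<mu>] by (force simp: prob_measures_def space_pair_measure)

lemma openin_phase_topology_sets:
  assumes "\<mu> \<in> prob_measures C" "countable C"
    and "openin (phase_topology interval_topology C) W"
  shows "W \<in> sets \<mu>"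
proof -
  have "(\<lambda>(x, c, a). (x, c, a) \<in> W) \<in> measurable \<mu> (count_space UNIV)"
  proof (rule measurable_phase[OF assms(1,2)])
    fix c a assume "c \<in> C" "a \<in> branches"
    then have "openin interval_topology {x. (x, c, a) \<in> W}"
      using assms(3) by (auto simp: openin_phase_topology_iff)
    then show "(\<lambda>x. (x, c, a) \<in> W) \<in> measurable borel (count_space UNIV)"
      using openin_interval_topology_imp_borel by (simp add: pred_def)
  qed
  then have "{p \<in> space \<mu>. p \<in> W} \<in> sets \<mu>"
    by (simp add: pred_def case_prod_unfold)
  moreover have "W \<subseteq> space \<mu>"
    using assms(3) space_phase[OF assms(1)] by (auto simp: openin_phase_topology_iff)
  ultimately show ?thesis by (simp add: Collect_conj_eq Int_absorb1)
qed

lemma integrable_phase: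
  assumes "\<mu> \<in> prob_measures C" "finite C"
    and f: "\<And>c a. c \<in> C \<Longrightarrow> a \<in> branches \<Longrightarrow> interval_extendable (f c a)"
  shows "integrable \<mu> (\<lambda>(x, c, a). f c a x)"
proof -
  interpret prob_space \<mu> using assms(1) by (simp add: prob_measures_def)
  have "bounded (\<Union>c\<in>C. \<Union>a\<in>branches. range (f c a))"
    using f assms(2) by (intro bounded_UN ballI interval_extendable_bounded) auto
  then obtain K where K: "\<And>c a x. c \<in> C \<Longrightarrow> a \<in> branches \<Longrightarrow> \<bar>f c a x\<bar> \<le> K"
    unfolding bounded_iff by fastforce
  show ?thesis
  proof (rule integrable_const_bound)
    show "AE p in \<mu>. norm (case p of (x, c, a) \<Rightarrow> f c a x) \<le> K"
      by (rule AE_I2) (use K space_phase[OF assms(1)] in auto)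
    show "(\<lambda>(x, c, a). f c a x) \<in> borel_measurable \<mu>"
      using f by (intro measurable_phase[OF assms(1)] interval_extendable_measurable
          countable_finite assms(2)) auto
  qed
qed

lemma AE_in_supp_interval:
  assumes "\<mu> \<in> prob_measures C" "countable C"
  shows "AE p in \<mu>. p \<in> supp (phase_topology interval_topology C) \<mu>"
  using assms
  by (intro AE_in_supp second_countable_phase_topology second_countable_interval_topology
      openin_phase_topology_sets)
    (auto simp: topspace_phase_topology topspace_interval_topology space_phase)

lemma supp_interval_subset_supp_euclidean:
  "supp (phase_topology interval_topology C) \<mu> \<subseteq> supp (phase_topology euclidean C) \<mu>"
proof -
  have "openin (phase_topology interval_topology C) U"
    if "openin (phase_topology euclidean C) U" for U
    using that open_imp_openin_interval_topology
    by (auto simp: openin_phase_topology_iff)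
  then show ?thesis
    by (auto simp: supp_def topspace_phase_topology)
qed

text \<open>
  Removing \<open>to_circle 0\<close> from an interval-open neighbourhood of \<open>x \<noteq> to_circle 0\<close> leaves a
  neighbourhood of \<open>x\<close> in the usual topology, which has positive measure if the point is in the
  usual support.
\<close>

lemma supp_euclidean_subset_supp_interval:
  assumes "\<mu> \<in> prob_measures C" "countable C"
  shows "supp (phase_topology euclidean C) \<mu> - {to_circle 0} \<times> UNIV
    \<subseteq> supp (phase_topology interval_topology C) \<mu>"
proof
  fix p assume "p \<in> supp (phase_topology euclidean C) \<mu> - {to_circle 0} \<times> UNIV"
  then obtain x c a where p: "p = (x, c, a)" "x \<noteq> to_circle 0" "c \<in> C" "a \<in> branches"
    and pos: "\<And>U. openin (phase_topology euclidean C) U \<Longrightarrow> p \<in> U \<Longrightarrow> emeasure \<mu> U > 0"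
    by (auto simp: supp_def topspace_phase_topology)
  have "emeasure \<mu> W > 0" if W: "openin (phase_topology interval_topology C) W" "p \<in> W" for W
  proof -
    let ?U = "({y. (y, c, a) \<in> W} - {to_circle 0}) \<times> {(c, a)}"
    have "open ({y. (y, c, a) \<in> W} - {to_circle 0})"
      using W p by (intro openin_interval_topology_imp_open) (auto simp: openin_phase_topology_iff)
    then have "openin (phase_topology euclidean C) ?U"
      using p by (intro openin_phase_topology_fibre) auto
    then have "emeasure \<mu> ?U > 0" using pos W(2) p by auto
    also have "emeasure \<mu> ?U \<le> emeasure \<mu> W"
      by (rule emeasure_mono) (auto intro: openin_phase_topology_sets[OF assms W(1)])
    finally show ?thesis .
  qed
  then show "p \<in> supp (phase_topology interval_topology C) \<mu>"
    using p by (auto simp: supp_def topspace_phase_topology topspace_interval_topology)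
qed

section \<open>Maximizing measures and the contact set\<close>

definition gap :: "'c set \<Rightarrow> ('c \<Rightarrow> circle \<Rightarrow> real) \<Rightarrow> (circle \<Rightarrow> real) \<Rightarrow> 'c \<Rightarrow> nat \<Rightarrow> circle \<Rightarrow> real"
  where "gap C A v c a x = (A c (tau a x) - max_action C A) + d_op x v a"

lemma interval_extendable_gap:
  assumes "continuous_on UNIV (A c)" "continuous_on UNIV v"
  shows "interval_extendable (gap C A v c a)"
  unfolding gap_def d_op_def
  by (intro interval_extendable_add interval_extendable_diff interval_extendable_tau
      interval_extendable_continuous assms continuous_on_const)

text \<open>
  Holonomic measures annihilate the coboundary of \<open>v\<close>, so adding it to the potential changes no
  integral.
\<close>

lemma integral_gap:
  assumes "finite C" and A: "\<And>c. c \<in> C \<Longrightarrow> continuous_on UNIV (A c)"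
    and v: "continuous_on UNIV v" and \<mu>: "\<mu> \<in> holonomic C"
  shows "(\<integral>(x, c, a). gap C A v c a x \<partial>\<mu>) = action A \<mu> - max_action C A"
proof -
  have P: "\<mu> \<in> prob_measures C" using \<mu> by (simp add: holonomic_def)
  interpret prob_space \<mu> using P by (simp add: prob_measures_def)
  have 1: "integrable \<mu> (\<lambda>(x, c, a). A c (tau a x))"
    using A by (intro integrable_phase[OF P assms(1)] interval_extendable_tau)
  have 2: "integrable \<mu> (\<lambda>(x, c, a). d_op x v a)"
    unfolding d_op_def
    by (intro integrable_phase[OF P assms(1)] interval_extendable_diff interval_extendable_tau
        interval_extendable_continuous v)
  have "(\<integral>(x, c, a). gap C A v c a x \<partial>\<mu>)
      = (\<integral>p. ((case p of (x, c, a) \<Rightarrow> A c (tau a x)) - max_action C A)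
          + (case p of (x, c, a) \<Rightarrow> d_op x v a) \<partial>\<mu>)"
    by (rule Bochner_Integration.integral_cong) (auto simp: gap_def)
  also have "\<dots> = action A \<mu> - max_action C A + (\<integral>(x, c, a). d_op x v a \<partial>\<mu>)"
    using 1 2 by (simp add: action_def prob_space)
  also have "(\<integral>(x, c, a). d_op x v a \<partial>\<mu>) = 0"
    using \<mu> v by (simp add: holonomic_def)
  finally show ?thesis by simp
qed

text \<open>
  A nonpositive integrable function has integral zero only if it vanishes almost everywhere.
\<close>

lemma maximizing_iff_AE_contact:
  assumes "finite C" and A: "\<And>c. c \<in> C \<Longrightarrow> continuous_on UNIV (A c)"
    and v: "continuous_on UNIV v"
    and gap: "\<And>c a x. c \<in> C \<Longrightarrow> a \<in> branches \<Longrightarrow> gap C A v c a x \<le> 0"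
    and \<mu>: "\<mu> \<in> holonomic C"
  shows "maximizing C A \<mu> \<longleftrightarrow> (AE p in \<mu>. p \<in> contact_set C A v)"
proof -
  have P: "\<mu> \<in> prob_measures C" using \<mu> by (simp add: holonomic_def)
  let ?g = "\<lambda>(x, c, a). gap C A v c a x"
  have int: "integrable \<mu> ?g"
    using A v by (intro integrable_phase[OF P assms(1)] interval_extendable_gap)
  have "maximizing C A \<mu> \<longleftrightarrow> (\<integral>p. - ?g p \<partial>\<mu>) = 0"
    using integral_gap[OF assms(1) A v \<mu>] \<mu> by (auto simp: maximizing_def)
  also have "\<dots> \<longleftrightarrow> (AE p in \<mu>. - ?g p = 0)"
  proof (rule integral_nonneg_eq_0_iff_AE)
    show "AE p in \<mu>. 0 \<le> - ?g p"
      by (rule AE_I2) (use gap space_phase[OF P] in auto)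
  qed (use int in simp)
  also have "\<dots> \<longleftrightarrow> (AE p in \<mu>. p \<in> contact_set C A v)"
    by (rule AE_cong) (auto simp: contact_set_def gap_def space_phase[OF P])
  finally show ?thesis .
qed

text \<open>
  On each copy of the circle \<open>gap\<close> is continuous for the interval topology, so the complement of
  the contact set is open there; it is null iff it misses the support.
\<close>

lemma AE_contact_iff_supp_interval:
  assumes "countable C" and A: "\<And>c. c \<in> C \<Longrightarrow> continuous_on UNIV (A c)"
    and v: "continuous_on UNIV v" and P: "\<mu> \<in> prob_measures C"
  shows "(AE p in \<mu>. p \<in> contact_set C A v) \<longleftrightarrow>
    supp (phase_topology interval_topology C) \<mu> \<subseteq> contact_set C A v"
proof
  assume AE: "AE p in \<mu>. p \<in> contact_set C A v"
  show "supp (phase_topology interval_topology C) \<mu> \<subseteq> contact_set C A v"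
  proof (rule subsetI, rule ccontr)
    fix p assume p: "p \<in> supp (phase_topology interval_topology C) \<mu>" "p \<notin> contact_set C A v"
    obtain x c a where pp: "p = (x, c, a)" by (cases p)
    have ca: "c \<in> C" "a \<in> branches"
      using p pp by (auto simp: supp_def topspace_phase_topology)
    let ?W = "(gap C A v c a -` (- {0})) \<times> {(c, a)}"
    have W: "openin (phase_topology interval_topology C) ?W"
      using ca A v
      by (intro openin_phase_topology_fibre interval_extendable_openin interval_extendable_gap) auto
    have "p \<in> ?W" using p(2) ca by (auto simp: pp contact_set_def gap_def)
    then have "emeasure \<mu> ?W > 0" using p(1) W by (auto simp: supp_def)
    moreover have "AE p in \<mu>. p \<notin> ?W"
      using AE by eventually_elim (auto simp: contact_set_def gap_def)
    then have "?W \<in> null_sets \<mu>"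
      using openin_phase_topology_sets[OF P assms(1) W] by (simp add: AE_iff_null_sets)
    ultimately show False by auto
  qed
next
  assume "supp (phase_topology interval_topology C) \<mu> \<subseteq> contact_set C A v"
  then show "AE p in \<mu>. p \<in> contact_set C A v"
    using AE_in_supp_interval[OF P assms(1)] by (auto elim: eventually_mono)
qed

lemma G_bar_contact:
  assumes "(x, c, a) \<in> contact_set C A v"
  shows "G_bar C A c (tau a x, v (tau a x)) = (x, v x)"
  using assms by (auto simp: G_bar_def doubling_tau contact_set_def d_op_def)

theorem theorem3p7:
  fixes C :: "'c set"
    and A :: "'c \<Rightarrow> circle \<Rightarrow> real"
    and v :: "circle \<Rightarrow> real"
    and \<mu> :: "(circle \<times> 'c \<times> nat) measure"
  assumes "finite C" and "card C \<ge> 2"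
    and "\<And>c. c \<in> C \<Longrightarrow> \<exists>L. L-lipschitz_on UNIV (A c)"
    and "continuous_on UNIV v"
    and "\<And>x. 0 = (SUP (c, a)\<in>C \<times> branches. (A c (tau a x) - max_action C A) + d_op x v a)"
    and "\<mu> \<in> holonomic C"
  shows "(maximizing C A \<mu> \<longleftrightarrow>
        supp (phase_topology interval_topology C) \<mu> \<subseteq> contact_set C A v) \<and>
      (supp (phase_topology euclidean C) \<mu> \<subseteq> contact_set C A v \<longrightarrow> maximizing C A \<mu>) \<and>
      (maximizing C A \<mu> \<longrightarrow>
        supp (phase_topology euclidean C) \<mu> - {to_circle 0} \<times> UNIV \<subseteq> contact_set C A v) \<and>
      (maximizing C A \<mu> \<longrightarrow>
        (AE (x, c, a) in \<mu>. G_bar C A c (tau a x, v (tau a x)) = (x, v x)))"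
proof -
  have A: "continuous_on UNIV (A c)" if "c \<in> C" for c
    using assms(3)[OF that] lipschitz_on_continuous_on by blast
  have P: "\<mu> \<in> prob_measures C" using assms(6) by (simp add: holonomic_def)
  have C: "countable C" using assms(1) by (rule countable_finite)
  have gap: "gap C A v c a x \<le> 0" if "c \<in> C" "a \<in> branches" for c a x
  proof -
    have "(case (c, a) of (c, a) \<Rightarrow> gap C A v c a x)
        \<le> (SUP (c, a)\<in>C \<times> branches. gap C A v c a x)"
      by (rule cSUP_upper) (use that assms(1) in \<open>auto intro!: bdd_above_finite\<close>)
    then show ?thesis using assms(5)[of x] by (simp add: gap_def)
  qed
  have AE: "maximizing C A \<mu> \<longleftrightarrow> (AE p in \<mu>. p \<in> contact_set C A v)"
    by (rule maximizing_iff_AE_contact[OF assms(1) A assms(4) gap assms(6)])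
  have iff: "maximizing C A \<mu> \<longleftrightarrow>
      supp (phase_topology interval_topology C) \<mu> \<subseteq> contact_set C A v"
    using AE AE_contact_iff_supp_interval[OF C A assms(4) P] by simp
  have "AE (x, c, a) in \<mu>. G_bar C A c (tau a x, v (tau a x)) = (x, v x)" if "maximizing C A \<mu>"
  proof -
    have "AE p in \<mu>. p \<in> contact_set C A v" using AE that by simp
    then show ?thesis
      by eventually_elim (auto simp: G_bar_contact)
  qed
  then show ?thesis
    using iff supp_interval_subset_supp_euclidean[of C \<mu>]
      supp_euclidean_subset_supp_interval[OF P C] by blast
qed

end
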